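(* Let $R=Q/P$ be a nonconstant rational function with $P,Q\in\mathbb{C}[z]$ coprime. Assume that near infinity $$R'(z)=c\,z^m+O(z^{m-1}),\qquad c\neq0,$$ where $m\in\mathbb{Z}$. If $m\neq0$, then outside a sufficiently large disk the inflection curve $\mathfrak{I}_R$ consists of $2|m|$ smooth unbounded arcs asymptotic to the rays $$\arg z=\frac{j\pi-\arg c}{m},\qquad j\in\mathbb{Z},$$ where the right-hand side is taken modulo $2\pi$. If $m=0$, then $R'(z)\to c$ as $z\to\infty$, and in this case $\mathfrak{I}_R$ is bounded whenever $\operatorname{Im}c\neq0$.
   Context: The affine inflection curve $\mathfrak{I}_R$ is the closure in $\mathbb{C}$ of $\{z\in\mathbb{C}: R(z)\neq0,\ P(z)\neq0,\ \operatorname{Im}R'(z)=0\}$; equivalently it is the zero set in $\mathbb{C}$ of $F_R=\frac{1}{2i}\bigl(W\overline{P}^{\,2}-\overline{W}P^2\bigr)$ with $W=Q'P-QP'$. "Asymptotic to a ray" is meant in the sense of asymptotic directions: along the arc, as $|z|\to\infty$, $\arg z$ tends to the argument of the ray, and exactly one arc corresponds to each of the $2|m|$ rays. *)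

theory Defs
  imports
    "HOL-Complex_Analysis.Complex_Analysis"
    "HOL-Library.Landau_Symbols"
    "HOL-Computational_Algebra.Computational_Algebra"
begin

text \<open>The rational function \<open>Q/P\<close>, as a function on the complement of its poles.  At a zero of
  \<open>P\<close> the value is the junk value \<open>0\<close>, so such points have to be excluded explicitly.\<close>

definition rational_fun :: "complex poly \<Rightarrow> complex poly \<Rightarrow> complex \<Rightarrow> complex" where
  "rational_fun Q P z = poly Q z / poly P z"

definition inflection_curve :: "complex poly \<Rightarrow> complex poly \<Rightarrow> complex set" where
  "inflection_curve Q P =
     closure {z. rational_fun Q P z \<noteq> 0 \<and> poly P z \<noteq> 0 \<and> Im (deriv (rational_fun Q P) z) = 0}"

text \<open>An infinitely differentiable parametrisation with nowhere vanishing velocity, on an interval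
  \<open>S\<close>: \<open>D k\<close> is the \<open>k\<close>-th derivative (one-sided at endpoints that belong to \<open>S\<close>).\<close>

definition smooth_regular_on :: "real set \<Rightarrow> (real \<Rightarrow> complex) \<Rightarrow> bool" where
  "smooth_regular_on S \<gamma> \<longleftrightarrow>
     (\<exists>D. D 0 = \<gamma> \<and>
          (\<forall>k. \<forall>t\<in>S. (D k has_vector_derivative D (Suc k) t) (at t within S)) \<and>
          (\<forall>t\<in>S. D 1 t \<noteq> 0))"

text \<open>An embedded smooth half-line: it has one (finite) endpoint, and its other end runs off to
  infinity.  Injectivity and properness make \<open>\<gamma>\<close> a homeomorphism onto a closed set.\<close>

definition unbounded_smooth_arc :: "complex set \<Rightarrow> bool" where
  "unbounded_smooth_arc A \<longleftrightarrow>
     (\<exists>\<gamma>. A = \<gamma> ` {0..} \<and> inj_on \<gamma> {0..} \<and> smooth_regular_on {0..} \<gamma> \<and>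
          filterlim \<gamma> at_infinity at_top)"

text \<open>Along \<open>A\<close>, as \<open>|z| \<rightarrow> \<infinity>\<close>, \<open>arg z\<close> tends to \<open>\<theta>\<close> modulo \<open>2\<pi>\<close>.  Composing with \<open>cis\<close> takes
  care of the reduction modulo \<open>2\<pi>\<close> and of the jump of the principal argument.  The condition
  is vacuous for bounded \<open>A\<close>; it is used for unbounded arcs only.\<close>

definition asymptotic_to_ray :: "complex set \<Rightarrow> real \<Rightarrow> bool" where
  "asymptotic_to_ray A \<theta> \<longleftrightarrow>
     ((\<lambda>z. cis (Arg z)) \<longlongrightarrow> cis \<theta>) (inf at_infinity (principal A))"

end

theory Submission
  imports Defs
begin

text \<open>In the coordinate \<open>u = 1/z\<close>, the function \<open>F(u) = R'(1/u) u^m / c\<close> extends holomorphically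
  to \<open>0\<close> with \<open>F(0) = 1\<close>, so \<open>w = u F(u)^(-1/m)\<close> is a local coordinate at infinity in which
  \<open>R' = c w^(-m)\<close> exactly.  With \<open>Z = 1/w\<close> the curve \<open>Im R' = 0\<close> becomes the union of the rays in the
  \<open>2|m|\<close> unit directions \<open>e\<close> for which \<open>c e^m\<close> is real, and the arcs are the images of these rays under
  the inverse chart \<open>z = \<psi>(Z)\<close>.  As \<open>Z \<psi>'(Z) / \<psi>(Z) \<rightarrow> 1\<close>, the modulus \<open>|z|\<close> increases along each ray near
  infinity; hence every circle \<open>|z| = r\<close> with \<open>r\<close> large cuts each arc exactly once.\<close>

section \<open>A coordinate at infinity turning the derivative into a pure power\<close>

text \<open>The equation \<open>w powi m * F u = u powi m\<close> is solved by w = u F^(-1/m). Since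
  F(0) = 1, the principal branch of this root is holomorphic near 0 and equals 1 there, so w has
  derivative 1 at 0 and is locally invertible, with inverse \<phi>.\<close>

lemma holomorphic_power_coordinate:
  fixes F :: "complex \<Rightarrow> complex" and m :: int
  assumes hol: "F holomorphic_on ball 0 d" and "d > 0" and F0: "F 0 = 1" and "m \<noteq> 0"
  obtains w \<phi> \<delta> \<epsilon> where "0 < \<delta>" "\<delta> \<le> d" "0 < \<epsilon>" "w holomorphic_on ball 0 \<delta>" "w 0 = 0"
    "deriv w 0 = 1" "\<phi> holomorphic_on ball 0 \<epsilon>" "deriv \<phi> 0 = 1"
    "\<And>W. W \<in> ball 0 \<epsilon> \<Longrightarrow> \<phi> W \<in> ball 0 \<delta> \<and> w (\<phi> W) = W"
    "\<And>u. u \<in> ball 0 \<delta> \<Longrightarrow> \<phi> (w u) = u"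
    "\<And>u. u \<in> ball 0 \<delta> \<Longrightarrow> w u powi m * F u = u powi m"
proof -
  define w where "w u = u * exp (- (Ln (F u) / of_int m))" for u
  have "isCont F 0"
    using holomorphic_on_imp_continuous_on[OF hol] \<open>d > 0\<close>
    by (metis centre_in_ball continuous_on_eq_continuous_at open_ball)
  then obtain d1 where "d1 > 0" and "\<forall>u. dist u 0 < d1 \<longrightarrow> dist (F u) (F 0) < 1"
    unfolding continuous_at_eps_delta by (meson zero_less_one)
  then have d1: "norm (F u - 1) < 1" if "u \<in> ball 0 d1" for u
    using F0 that by (simp add: dist_norm)
  define d2 where "d2 = min d d1"
  have d2: "0 < d2" "d2 \<le> d" "\<And>u. u \<in> ball 0 d2 \<Longrightarrow> norm (F u - 1) < 1"
    using \<open>d > 0\<close> \<open>d1 > 0\<close> d1 by (auto simp: d2_def)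
  \<comment> \<open>Positive real part keeps \<open>F u\<close> off the branch cut of
    \<open>Ln\<close> and away from 0.\<close>
  have Re_pos: "Re (F u) > 0" if "u \<in> ball 0 d2" for u
    using d2(3)[OF that] abs_Re_le_cmod[of "F u - 1"] by simp
  have hol2: "F holomorphic_on ball 0 d2"
    using hol d2(2) by (meson holomorphic_on_subset subset_ball)
  have F_slit: "F u \<notin> \<real>\<^sub>\<le>\<^sub>0" if "u \<in> ball 0 d2" for u
    using Re_pos[OF that] by (auto simp: complex_nonpos_Reals_iff)
  have holw: "w holomorphic_on ball 0 d2"
    unfolding w_def by (intro holomorphic_intros hol2) (use F_slit \<open>m \<noteq> 0\<close> in auto)
  have w0: "w 0 = 0" by (simp add: w_def)
  have "(F \<longlongrightarrow> 1) (at 0)"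
    using \<open>isCont F 0\<close> F0 unfolding isCont_def by simp
  then have "((\<lambda>u. exp (- (Ln (F u) / of_int m))) \<longlongrightarrow> exp (- (Ln 1 / of_int m))) (at 0)"
    by (intro tendsto_exp tendsto_minus tendsto_divide tendsto_Ln tendsto_const) (use \<open>m \<noteq> 0\<close> in simp_all)
  also have "?this \<longleftrightarrow> ((\<lambda>u. w u / u) \<longlongrightarrow> 1) (at 0)"
    unfolding w_def by (simp add: LIM_equal)
  finally have "((\<lambda>u. w u / u) \<longlongrightarrow> 1) (at 0)" .
  then have dw: "(w has_field_derivative 1) (at 0)"
    by (simp add: DERIV_def w0)
  then have dw1: "deriv w 0 = 1" by (rule DERIV_imp_deriv)
  obtain \<delta> where \<delta>: "\<delta> > 0" "ball (0::complex) \<delta> \<subseteq> ball 0 d2" "inj_on w (ball 0 \<delta>)"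
    using has_complex_derivative_locally_injective[OF holw, of 0] d2(1) dw1 by auto
  have holw': "w holomorphic_on ball 0 \<delta>"
    using holw \<delta>(2) by (rule holomorphic_on_subset)
  obtain \<phi> where \<phi>: "\<phi> holomorphic_on (w ` ball 0 \<delta>)"
      "\<And>z. z \<in> ball 0 \<delta> \<Longrightarrow> deriv w z * deriv \<phi> (w z) = 1"
      "\<And>z. z \<in> ball 0 \<delta> \<Longrightarrow> \<phi> (w z) = z"
    using holomorphic_has_inverse[OF holw' open_ball \<delta>(3)] by blast
  have "open (w ` ball 0 \<delta>)"
    using open_mapping_thm3[OF holw' open_ball \<delta>(3)] .
  moreover have "0 \<in> w ` ball 0 \<delta>"
    using \<delta>(1) w0 by (metis centre_in_ball image_eqI)
  \<comment> \<open>The inverse lives on the image of \<open>ball 0 \<delta>\<close>, which by the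
    open mapping theorem contains a ball around \<open>w 0 = 0\<close>.\<close>
  ultimately obtain \<epsilon> where \<epsilon>: "\<epsilon> > 0" "ball (0::complex) \<epsilon> \<subseteq> w ` ball 0 \<delta>"
    by (meson openE)
  show thesis
  proof (rule that[of \<delta> \<epsilon> w \<phi>])
    show "\<delta> \<le> d"
      using \<delta>(1,2) d2(2) by (auto simp: ball_subset_ball_iff)
    show "deriv \<phi> 0 = 1"
      using \<phi>(2)[of 0] \<delta>(1) w0 dw1 by simp
    show "\<phi> holomorphic_on ball 0 \<epsilon>"
      using \<phi>(1) \<epsilon>(2) by (rule holomorphic_on_subset)
    show "\<phi> W \<in> ball 0 \<delta> \<and> w (\<phi> W) = W" if W: "W \<in> ball 0 \<epsilon>" for W
      proof -
      obtain u where "u \<in> ball 0 \<delta>" "W = w u" using W \<epsilon>(2) by blast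
      then show ?thesis using \<phi>(3) by simp
    qed
    show "w u powi m * F u = u powi m" if "u \<in> ball 0 \<delta>" for u
    proof -
      have nz: "F u \<noteq> 0" using Re_pos[of u] that \<delta>(2) by auto
      have "exp (- (Ln (F u) / of_int m)) powi m = exp (of_int m * - (Ln (F u) / of_int m))"
        by (simp add: exp_power_int)
      also have "\<dots> = inverse (F u)"
        using nz \<open>m \<noteq> 0\<close> by (simp add: exp_minus)
      finally show ?thesis
        using nz by (simp add: w_def power_int_mult_distrib)
    qed
  qed (use \<delta> \<epsilon> holw' w0 dw1 \<phi>(3) in auto)
qed

text \<open>The local coordinate w and its inverse \<phi>, conjugated by inversion, give
  \<open>\<omega> z = 1 / w (1 / z)\<close> and \<open>\<psi> Z = 1 / \<phi> (1 / Z)\<close>. The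
  positive real part will make the modulus of \<psi> increase along rays, and the limit of
  \<open>\<omega> z / z\<close> will transfer the direction of a ray to that of its image.\<close>

lemma holomorphic_normal_form_at_infinity:
  fixes f :: "complex \<Rightarrow> complex" and m :: int
  assumes hol: "f holomorphic_on {z. r0 < norm z}"
    and lim: "((\<lambda>z. f z / z powi m) \<longlongrightarrow> c) at_infinity" and "c \<noteq> 0" and "m \<noteq> 0"
  obtains \<psi> \<omega> \<rho>0 where "\<rho>0 > 0" "\<psi> holomorphic_on {Z. \<rho>0 < norm Z}"
    "\<And>Z. \<rho>0 < norm Z \<Longrightarrow> \<psi> Z \<noteq> 0"
    "\<And>Z. \<rho>0 < norm Z \<Longrightarrow> \<omega> (\<psi> Z) = Z"
    "\<And>Z. \<rho>0 < norm Z \<Longrightarrow> Re (Z * deriv \<psi> Z / \<psi> Z) > 0"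
    "\<And>Z. \<rho>0 < norm Z \<Longrightarrow> f (\<psi> Z) = c * Z powi m"
    "filterlim \<psi> at_infinity at_infinity"
    "\<forall>\<^sub>F z in at_infinity. \<rho>0 < norm (\<omega> z) \<and> \<psi> (\<omega> z) = z"
    "((\<lambda>z. \<omega> z / z) \<longlongrightarrow> 1) at_infinity"
proof -
  \<comment> \<open>The maximum with 1 keeps d meaningful when \<open>r0\<close> is not positive;
    inversion then maps the punctured disk of radius d into the domain of f.\<close>
  define d where "d = 1 / max r0 1"
  have "d > 0" by (simp add: d_def)
  have d: "r0 < norm (inverse u)" if "norm u < d" "u \<noteq> 0" for u :: complex
  proof -
    have "norm u * max r0 1 < 1"
      using that(1) by (simp add: d_def field_simps)
    moreover have "M < norm (inverse u)" if "norm u * M < 1" for M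
      using that \<open>u \<noteq> 0\<close> by (simp only: norm_inverse) (simp add: field_simps)
    ultimately have "max r0 1 < norm (inverse u)" by blast
    then show ?thesis by linarith
  qed
  define F0 where "F0 u = f (inverse u) * u powi m / c" for u
  \<comment> \<open>The value 1 is the limit of \<open>F0\<close> at 0, so the singularity there is
    removable.\<close>
  define F where "F u = (if u = 0 then 1 else F0 u)" for u
  have "((\<lambda>u. f (inverse u) / inverse u powi m / c) \<longlongrightarrow> c / c) (at 0)"
    using lim \<open>c \<noteq> 0\<close> unfolding lim_at_infinity_0 o_def by (intro tendsto_divide tendsto_const) auto
  then have F0_lim: "(F0 \<longlongrightarrow> 1) (at 0)"
    using \<open>c \<noteq> 0\<close> by (simp add: F0_def[abs_def] power_int_inverse divide_inverse)
  have "(\<lambda>u. f (inverse u)) holomorphic_on ball 0 d - {0}"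
  proof (rule holomorphic_on_compose_gen[OF _ hol, unfolded o_def])
    show "inverse holomorphic_on ball 0 d - {0 :: complex}"
      by (intro holomorphic_intros) auto
    show "inverse ` (ball (0 :: complex) d - {0}) \<subseteq> {z. r0 < norm z}"
      using d by auto
  qed
  then have "F0 holomorphic_on ball 0 d - {0}"
    unfolding F0_def by (intro holomorphic_intros) (use \<open>c \<noteq> 0\<close> in auto)
  then have holF: "F holomorphic_on ball 0 d"
    unfolding F_def[abs_def] by (rule removable_singularity[OF _ open_ball F0_lim])
  have "F 0 = 1" by (simp add: F_def)
  obtain w \<phi> \<delta> \<epsilon> where \<delta>: "0 < \<delta>" "\<delta> \<le> d" and "0 < \<epsilon>" and holw: "w holomorphic_on ball 0 \<delta>"
    and w0: "w 0 = 0" and dw: "deriv w 0 = 1"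
    and hol\<phi>: "\<phi> holomorphic_on ball 0 \<epsilon>" and d\<phi>: "deriv \<phi> 0 = 1"
    and \<phi>: "\<And>W. W \<in> ball 0 \<epsilon> \<Longrightarrow> \<phi> W \<in> ball 0 \<delta> \<and> w (\<phi> W) = W"
    and \<phi>w: "\<And>u. u \<in> ball 0 \<delta> \<Longrightarrow> \<phi> (w u) = u"
    and wF: "\<And>u. u \<in> ball 0 \<delta> \<Longrightarrow> w u powi m * F u = u powi m"
    by (rule holomorphic_power_coordinate[OF holF \<open>d > 0\<close> \<open>F 0 = 1\<close> \<open>m \<noteq> 0\<close>]) blast
  have \<phi>0: "\<phi> 0 = 0"
    using \<phi>w[of 0] \<delta>(1) w0 by simp
  have w_der: "(w has_field_derivative 1) (at 0)"
    using holomorphic_derivI[OF holw open_ball, of 0] \<delta>(1) dw by simp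
  have \<phi>_der: "(\<phi> has_field_derivative 1) (at 0)"
    using holomorphic_derivI[OF hol\<phi> open_ball, of 0] \<open>0 < \<epsilon>\<close> d\<phi> by simp
  have w_quot: "((\<lambda>u. w u / u) \<longlongrightarrow> 1) (at 0)"
    using w_der by (simp add: DERIV_def w0)
  have \<phi>_quot: "((\<lambda>u. \<phi> u / u) \<longlongrightarrow> 1) (at 0)"
    using \<phi>_der by (simp add: DERIV_def \<phi>0)
  have "deriv \<phi> holomorphic_on ball 0 \<epsilon>"
    using hol\<phi> by (rule holomorphic_deriv) simp
  then have "isCont (deriv \<phi>) 0"
    using \<open>0 < \<epsilon>\<close>
    by (metis centre_in_ball continuous_on_eq_continuous_at holomorphic_on_imp_continuous_on open_ball)
  then have "(deriv \<phi> \<longlongrightarrow> 1) (at 0)"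
    using d\<phi> by (simp add: isCont_def)
  \<comment> \<open>With W = 1/Z, the quotient \<open>Z * deriv \<psi> Z / \<psi> Z\<close> equals
    \<open>deriv \<phi> W / (\<phi> W / W)\<close>, which tends to 1 as W tends to 0.\<close>
  then have "((\<lambda>W. Re (deriv \<phi> W / (\<phi> W / W))) \<longlongrightarrow> Re (1 / 1)) (at 0)"
    using \<phi>_quot by (intro tendsto_Re tendsto_divide) auto
  then have "\<forall>\<^sub>F W in at 0. 0 < Re (deriv \<phi> W / (\<phi> W / W))"
    by (rule order_tendstoD) simp
  then obtain \<epsilon>1 where "\<epsilon>1 > 0" and \<epsilon>1: "\<And>W. W \<noteq> 0 \<Longrightarrow> norm W < \<epsilon>1 \<Longrightarrow> 0 < Re (deriv \<phi> W / (\<phi> W / W))"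
    by (auto simp: eventually_at)
  define \<epsilon>2 where "\<epsilon>2 = min \<epsilon> \<epsilon>1"
  have "\<epsilon>2 > 0" using \<open>0 < \<epsilon>\<close> \<open>0 < \<epsilon>1\<close> by (simp add: \<epsilon>2_def)
  define \<rho>0 where "\<rho>0 = 1 / \<epsilon>2"
  define \<psi> where "\<psi> Z = inverse (\<phi> (inverse Z))" for Z
  define \<omega> where "\<omega> z = inverse (w (inverse z))" for z
  have "\<rho>0 > 0" using \<open>\<epsilon>2 > 0\<close> by (simp add: \<rho>0_def)
  have inv_small: "norm (inverse Z) < \<epsilon>2" "Z \<noteq> 0" if "\<rho>0 < norm Z" for Z :: complex
  proof -
    show "Z \<noteq> 0" using that \<open>\<rho>0 > 0\<close> by auto
    then show "norm (inverse Z) < \<epsilon>2" using that \<open>\<epsilon>2 > 0\<close> by (simp only: norm_inverse) (simp add: \<rho>0_def field_simps)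
  qed
  \<comment> \<open>If \<open>\<phi> W\<close> were 0, division by zero would make the quotient in
    \<open>\<epsilon>1\<close> equal to 0, against its positive real part.\<close>
  have \<phi>_nz: "\<phi> W \<noteq> 0" if "W \<noteq> 0" "norm W < \<epsilon>2" for W
    using \<epsilon>1[of W] that by (auto simp: \<epsilon>2_def)
  have \<epsilon>2_ball: "W \<in> ball 0 \<epsilon>" if "norm W < \<epsilon>2" for W :: complex
    using that by (simp add: \<epsilon>2_def)
  have w_nz: "w u \<noteq> 0" if "u \<in> ball 0 \<delta>" "u \<noteq> 0" for u
    using \<phi>w[OF that(1)] that(2) \<phi>0 by auto
  have \<psi>_der: "(\<psi> has_field_derivative deriv \<phi> (inverse Z) * inverse Z ^ 2 * inverse (\<phi> (inverse Z)) ^ 2) (at Z)"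
    if "\<rho>0 < norm Z" for Z
  proof -
    note Z = inv_small[OF that]
    have "\<phi> (inverse Z) \<noteq> 0" using \<phi>_nz Z by simp
    moreover have "(\<phi> has_field_derivative deriv \<phi> (inverse Z)) (at (inverse Z))"
      using holomorphic_derivI[OF hol\<phi> open_ball] \<epsilon>2_ball Z by blast
    then have "((\<lambda>Z. \<phi> (inverse Z)) has_field_derivative deriv \<phi> (inverse Z) * - (inverse Z ^ Suc (Suc 0))) (at Z)"
      using Z(2) by (intro DERIV_chain2[where f = \<phi>] DERIV_inverse) auto
    ultimately show ?thesis
      unfolding \<psi>_def[abs_def] by (auto intro!: derivative_eq_intros simp: power2_eq_square)
  qed
  have \<psi>_lim: "filterlim \<psi> at_infinity at_infinity"
  proof -
    have "isCont \<phi> 0" using \<phi>_der by (rule DERIV_isCont)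
    then have "(\<phi> \<longlongrightarrow> 0) (at 0)" using \<phi>0 by (simp add: isCont_def)
    moreover have "\<forall>\<^sub>F W in at 0. \<phi> W \<noteq> 0"
      using \<phi>_nz \<open>\<epsilon>2 > 0\<close> unfolding eventually_at by auto
    ultimately have "filterlim \<phi> (at 0) (at 0)" by (rule filterlim_atI)
    then have "filterlim (\<lambda>W. inverse (\<phi> W)) at_infinity (at 0)"
      by (rule filterlim_compose[OF filterlim_inverse_at_infinity])
    then show ?thesis
      unfolding \<psi>_def[abs_def] by (simp add: at_to_infinity filterlim_filtermap)
  qed
  show thesis
  proof (rule that[of \<rho>0 \<psi> \<omega>])
    show "\<psi> holomorphic_on {Z. \<rho>0 < norm Z}"
      using \<psi>_der by (intro holomorphic_onI) (auto simp: field_differentiable_def intro: has_field_derivative_at_within)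
    show "\<forall>\<^sub>F z in at_infinity. \<rho>0 < norm (\<omega> z) \<and> \<psi> (\<omega> z) = z"
    proof -
      have "isCont w 0" using w_der by (rule DERIV_isCont)
      then have "\<forall>\<^sub>F u in at 0. norm (w u) < \<epsilon>2"
        using w0 \<open>\<epsilon>2 > 0\<close> tendstoD[of w 0 "at 0" \<epsilon>2] by (simp add: isCont_def)
      moreover have "\<forall>\<^sub>F u in at 0. u \<in> ball 0 \<delta> - {0}"
        using \<delta>(1) unfolding eventually_at by (auto simp: dist_commute)
      ultimately have "\<forall>\<^sub>F u in at 0. \<rho>0 < norm (\<omega> (inverse u)) \<and> \<psi> (\<omega> (inverse u)) = inverse u"
      proof eventually_elim
        case (elim u)
        then have "w u \<noteq> 0" using w_nz by blast
        then show ?case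
          using elim \<phi>w \<open>\<epsilon>2 > 0\<close>
          by (simp add: \<omega>_def \<psi>_def \<rho>0_def norm_inverse inverse_eq_divide[of "norm _"] frac_less2)
      qed
      then show ?thesis
        by (simp add: at_to_infinity eventually_filtermap)
    qed
    show "((\<lambda>z. \<omega> z / z) \<longlongrightarrow> 1) at_infinity"
      using tendsto_inverse[OF w_quot] unfolding lim_at_infinity_0 o_def \<omega>_def
      by (simp add: field_simps)
  next
    fix Z :: complex assume "\<rho>0 < norm Z"
    note Z = inv_small[OF this] and der = DERIV_imp_deriv[OF \<psi>_der[OF this]]
    define W where "W = inverse Z"
    have W: "W \<noteq> 0" "norm W < \<epsilon>2" "W \<in> ball 0 \<epsilon>" "\<phi> W \<noteq> 0"
      using Z \<epsilon>2_ball \<phi>_nz by (auto simp: W_def)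
    show "\<psi> Z \<noteq> 0" using W(4) by (simp add: \<psi>_def W_def)
    show "\<omega> (\<psi> Z) = Z" using \<phi>[OF W(3)] by (simp add: \<psi>_def \<omega>_def W_def)
    have "Z * deriv \<psi> Z / \<psi> Z = deriv \<phi> W / (\<phi> W / W)"
      using Z(2) W(4) unfolding der by (simp add: \<psi>_def W_def field_simps power2_eq_square)
    then show "Re (Z * deriv \<psi> Z / \<psi> Z) > 0"
      using \<epsilon>1[of W] W by (simp add: \<epsilon>2_def)
    have \<psi>W: "\<psi> Z = inverse (\<phi> W)" by (simp add: \<psi>_def W_def)
    \<comment> \<open>This is the equation for w at the point \<open>\<phi> W\<close>. The factor
      \<open>\<phi> W powi m\<close> inside \<open>F0\<close> cancels against the right-hand side,
      leaving f composed with \<psi> as an exact power.\<close>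
    have "W powi m * F0 (\<phi> W) = \<phi> W powi m"
      using wF[of "\<phi> W"] \<phi>[OF W(3)] W(4) by (simp add: F_def)
    then have "W powi m * f (\<psi> Z) = c"
      using W(4) \<open>c \<noteq> 0\<close> by (simp add: F0_def \<psi>W divide_simps mult_ac)
    then show "f (\<psi> Z) = c * Z powi m"
      using Z(2) by (simp add: W_def divide_simps mult_ac)
  qed (fact \<open>\<rho>0 > 0\<close> \<psi>_lim)+
qed

section \<open>Images of rays under the chart\<close>

text \<open>At Z = t e the logarithmic derivative of |\<psi>(t e)| in t is Re(Z \<psi>'(Z) /
  \<psi>(Z)) / t, which is positive. The computation uses the squared modulus, a polynomial in the
  real and imaginary parts.\<close>

lemma norm_strict_mono_on_ray:
  fixes \<psi> :: "complex \<Rightarrow> complex"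
  assumes hol: "\<psi> holomorphic_on {Z. \<rho>0 < norm Z}" and "\<rho>0 > 0"
    and nz: "\<And>Z. \<rho>0 < norm Z \<Longrightarrow> \<psi> Z \<noteq> 0"
    and pos: "\<And>Z. \<rho>0 < norm Z \<Longrightarrow> Re (Z * deriv \<psi> Z / \<psi> Z) > 0"
    and e: "norm e = 1" and "\<rho>0 < a" "a < b"
  shows "norm (\<psi> (of_real a * e)) < norm (\<psi> (of_real b * e))"
proof -
  define h where "h t = \<psi> (of_real t * e)" for t :: real
  have opn: "open {Z :: complex. \<rho>0 < norm Z}"
    by (intro open_Collect_less continuous_intros)
  have "\<exists>y. ((\<lambda>t. (Re (h t))\<^sup>2 + (Im (h t))\<^sup>2) has_real_derivative y) (at t) \<and> y > 0"
    if "a \<le> t" for t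
  proof -
    define Z where "Z = of_real t * e"
    have t: "t > 0" and Z: "\<rho>0 < norm Z"
      using that \<open>\<rho>0 > 0\<close> \<open>\<rho>0 < a\<close> e by (auto simp: Z_def norm_mult)
    have "((\<lambda>\<zeta>. \<psi> (\<zeta> * e)) has_field_derivative deriv \<psi> Z * e) (at (of_real t))"
      unfolding Z_def
      by (rule DERIV_chain2[where f = \<psi>])
        (use holomorphic_derivI[OF hol opn, of Z] Z in \<open>auto simp: Z_def intro!: derivative_eq_intros\<close>)
    then have "(h has_vector_derivative deriv \<psi> Z * e) (at t)"
      unfolding h_def[abs_def] by (rule has_vector_derivative_real_field)
    then have der: "((\<lambda>t. Re (h t)) has_real_derivative Re (deriv \<psi> Z * e)) (at t)"
      "((\<lambda>t. Im (h t)) has_real_derivative Im (deriv \<psi> Z * e)) (at t)"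
      by (simp_all add: has_vector_derivative_complex_iff)
    have "((\<lambda>t. (Re (h t))\<^sup>2 + (Im (h t))\<^sup>2) has_real_derivative
        2 * (Re (deriv \<psi> Z * e) * Re (\<psi> Z) + Im (deriv \<psi> Z * e) * Im (\<psi> Z))) (at t)"
      using DERIV_add[OF DERIV_power[OF der(1), of 2] DERIV_power[OF der(2), of 2]]
      by (simp add: h_def Z_def algebra_simps del: times_complex.sel)
    \<comment> \<open>This sum is the squared modulus of \<open>\<psi> Z\<close> times the real part
      of \<open>deriv \<psi> Z * e / \<psi> Z\<close>, and the latter differs from the quotient in
      the hypothesis by the factor t > 0.\<close>
    moreover have "Re (deriv \<psi> Z * e) * Re (\<psi> Z) + Im (deriv \<psi> Z * e) * Im (\<psi> Z) > 0"
    proof -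
      have "Z * deriv \<psi> Z / \<psi> Z = of_real t * (deriv \<psi> Z * e / \<psi> Z)"
        by (simp add: Z_def)
      moreover have Re_of_real_mult: "Re (of_real t * q) = t * Re q" for q
        by simp
      ultimately have "t * Re (deriv \<psi> Z * e / \<psi> Z) > 0"
        using pos[OF Z] Re_of_real_mult by metis
      then have "Re (deriv \<psi> Z * e / \<psi> Z) > 0"
        using t by (simp only: zero_less_mult_iff) auto
      moreover have "(Re (\<psi> Z))\<^sup>2 + (Im (\<psi> Z))\<^sup>2 > 0"
        using nz[OF Z] by (simp add: complex_eq_iff sum_power2_gt_zero_iff)
      ultimately show ?thesis
        unfolding Re_divide by (simp only: zero_less_divide_iff) auto
    qed
    ultimately show ?thesis by (auto simp del: times_complex.sel)
  qed
  then have "(Re (h a))\<^sup>2 + (Im (h a))\<^sup>2 < (Re (h b))\<^sup>2 + (Im (h b))\<^sup>2"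
    using \<open>a < b\<close> by (intro DERIV_pos_imp_increasing[where f = "\<lambda>t. (Re (h t))\<^sup>2 + (Im (h t))\<^sup>2"]) auto
  then show ?thesis
    by (simp add: h_def cmod_def)
qed

text \<open>The parametrisation, shifted to start at 0, is the restriction of a holomorphic
  injective G to the half-line, whose open complex neighbourhood T includes the endpoint. Iterated
  complex derivatives of G therefore serve as all real derivatives, one-sided at 0, and injectivity
  of G forces its derivative to be nonzero.\<close>

lemma unbounded_smooth_arc_ray_image:
  fixes \<psi> :: "complex \<Rightarrow> complex"
  assumes hol: "\<psi> holomorphic_on {Z. \<rho>0 < norm Z}" and "\<rho>0 > 0"
    and inj: "inj_on \<psi> {Z. \<rho>0 < norm Z}"
    and lim: "filterlim \<psi> at_infinity at_infinity"
    and e: "norm e = 1" and "\<rho>0 < a"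
  shows "unbounded_smooth_arc ((\<lambda>\<rho>. \<psi> (of_real \<rho> * e)) ` {a..})"
proof -
  define T where "T = {\<zeta> :: complex. \<rho>0 < norm ((of_real a + \<zeta>) * e)}"
  define G where "G \<zeta> = \<psi> ((of_real a + \<zeta>) * e)" for \<zeta>
  define \<gamma> where "\<gamma> t = G (of_real t)" for t :: real
  have "e \<noteq> 0" using e by auto
  have norm_eq: "norm ((of_real a + of_real t) * e) = a + t" if "t \<ge> 0" for t :: real
    using that e \<open>\<rho>0 > 0\<close> \<open>\<rho>0 < a\<close> by (simp add: norm_mult flip: of_real_add)
  have T_pos: "of_real t \<in> T" if "t \<ge> 0" for t :: real
    using that norm_eq[OF that] \<open>\<rho>0 < a\<close> by (simp add: T_def)
  have "open T"
    unfolding T_def by (intro open_Collect_less continuous_intros)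
  have holG: "G holomorphic_on T"
    unfolding G_def[abs_def]
    by (rule holomorphic_on_compose_gen[OF _ hol, unfolded o_def])
      (auto intro!: holomorphic_intros simp: T_def)
  have injG: "inj_on G T"
  proof (rule inj_onI)
    fix x y assume "x \<in> T" "y \<in> T" "G x = G y"
    then have "(of_real a + x) * e = (of_real a + y) * e"
      using inj unfolding G_def T_def by (auto dest!: inj_onD)
    then show "x = y" using \<open>e \<noteq> 0\<close> by simp
  qed
  have "(\<lambda>\<rho>. \<psi> (of_real \<rho> * e)) ` {a..} = \<gamma> ` {0..}"
  proof -
    have "{a..} = (\<lambda>t. a + t) ` {0..}"
      by simp
    then show ?thesis
      unfolding \<gamma>_def G_def by (simp only: image_image of_real_add)
  qed
  moreover have "inj_on \<gamma> {0..}"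
    using inj_onD[OF injG] T_pos unfolding \<gamma>_def by (intro inj_onI) force
  moreover have "smooth_regular_on {0..} \<gamma>"
    unfolding smooth_regular_on_def
  proof (intro exI conjI allI ballI)
    show "(\<lambda>t. (deriv ^^ 0) G (of_real t)) = \<gamma>"
      by (simp add: \<gamma>_def fun_eq_iff)
    show "((\<lambda>t. (deriv ^^ k) G (of_real t)) has_vector_derivative (deriv ^^ Suc k) G (of_real t)) (at t within {0..})"
      if "t \<in> {0..}" for k and t :: real
    proof -
      have "(deriv ^^ k) G holomorphic_on T"
        using holG \<open>open T\<close> by (rule holomorphic_higher_deriv)
      then show ?thesis
        using holomorphic_derivI[OF _ \<open>open T\<close> T_pos] that
        by (intro has_vector_derivative_real_field) auto
    qed
    show "(deriv ^^ 1) G (of_real t) \<noteq> 0" if "t \<in> {0..}" for t :: real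
      using holomorphic_injective_imp_regular[OF holG \<open>open T\<close> injG] T_pos that by auto
  qed
  moreover have "filterlim \<gamma> at_infinity at_top"
  proof -
    have "filterlim (\<lambda>t. norm ((of_real a + of_real t) * e)) at_top at_top"
    proof (rule filterlim_at_top_mono)
      show "filterlim (\<lambda>t. a + t) at_top at_top"
        by (rule filterlim_tendsto_add_at_top[OF tendsto_const filterlim_ident])
      show "\<forall>\<^sub>F t in at_top. a + t \<le> norm ((of_real a + of_real t) * e)"
        using eventually_ge_at_top[of 0] by eventually_elim (use norm_eq in simp)
    qed
    then have "filterlim (\<lambda>t. (of_real a + of_real t) * e) at_infinity at_top"
      by (simp only: filterlim_at_infinity_conv_norm_at_top)
    then show ?thesis
      unfolding \<gamma>_def[abs_def] G_def by (rule filterlim_compose[OF lim])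
  qed
  ultimately show ?thesis
    unfolding unbounded_smooth_arc_def by blast
qed

text \<open>Nontriviality of this filter makes limits along an arc unique, so that an arc has only
  one asymptotic direction modulo 2\<pi>.\<close>

lemma inf_at_infinity_unbounded_smooth_arc:
  assumes "unbounded_smooth_arc A"
  shows "inf at_infinity (principal A) \<noteq> bot"
proof -
  obtain \<gamma> :: "real \<Rightarrow> complex" where \<gamma>: "A = \<gamma> ` {0..}" "filterlim \<gamma> at_infinity at_top"
    using assms by (auto simp: unbounded_smooth_arc_def)
  have "\<forall>\<^sub>F t in at_top. \<gamma> t \<in> A"
    using eventually_ge_at_top[of 0] by eventually_elim (simp add: \<gamma>(1))
  then have "filterlim \<gamma> (inf at_infinity (principal A)) at_top"
    using \<gamma>(2) by (simp add: filterlim_inf filterlim_principal)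
  then show ?thesis
    unfolding filterlim_def
    by (metis filtermap_bot_iff le_bot trivial_limit_at_top_linorder)
qed

section \<open>The real level set near infinity as a union of arcs\<close>

text \<open>On the ray in direction e the function f composed with \<psi> equals \<rho>^m c e^m,
  whose reality depends on e alone. So the level set is the image of the rays with direction in E,
  and monotonicity of the modulus makes truncation at |z| = r cut each image in a single
  point.\<close>

lemma holomorphic_real_level_arcs_at_infinity:
  fixes f :: "complex \<Rightarrow> complex" and m :: int
  assumes hol: "f holomorphic_on {z. r0 < norm z}"
    and lim: "((\<lambda>z. f z / z powi m) \<longlongrightarrow> c) at_infinity" and "c \<noteq> 0" and "m \<noteq> 0"
  defines "E \<equiv> {e. norm e = 1 \<and> Im (c * e powi m) = 0}"
  shows "\<forall>\<^sub>F r in at_top. \<exists>A.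
    (\<forall>e\<in>E. unbounded_smooth_arc (A e) \<and>
      ((\<lambda>z. cis (Arg z)) \<longlongrightarrow> e) (inf at_infinity (principal (A e)))) \<and>
    disjoint_family_on A E \<and> {z. r \<le> norm z \<and> Im (f z) = 0} = (\<Union>e\<in>E. A e)"
proof -
  obtain \<psi> \<omega> \<rho>0 where "\<rho>0 > 0" and hol\<psi>: "\<psi> holomorphic_on {Z. \<rho>0 < norm Z}"
    and \<psi>_nz: "\<And>Z. \<rho>0 < norm Z \<Longrightarrow> \<psi> Z \<noteq> 0"
    and \<omega>\<psi>: "\<And>Z. \<rho>0 < norm Z \<Longrightarrow> \<omega> (\<psi> Z) = Z"
    and \<psi>_pos: "\<And>Z. \<rho>0 < norm Z \<Longrightarrow> Re (Z * deriv \<psi> Z / \<psi> Z) > 0"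
    and f\<psi>: "\<And>Z. \<rho>0 < norm Z \<Longrightarrow> f (\<psi> Z) = c * Z powi m"
    and \<psi>_lim: "filterlim \<psi> at_infinity at_infinity"
    and \<psi>\<omega>: "\<forall>\<^sub>F z in at_infinity. \<rho>0 < norm (\<omega> z) \<and> \<psi> (\<omega> z) = z"
    and \<omega>_lim: "((\<lambda>z. \<omega> z / z) \<longlongrightarrow> 1) at_infinity"
    by (rule holomorphic_normal_form_at_infinity[OF assms(1-4)]) blast
  have inj: "inj_on \<psi> {Z. \<rho>0 < norm Z}"
    by (rule inj_on_inverseI[of _ \<omega>]) (use \<omega>\<psi> in auto)
  obtain r1 where r1: "\<And>z. r1 \<le> norm z \<Longrightarrow> \<rho>0 < norm (\<omega> z) \<and> \<psi> (\<omega> z) = z"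
    using \<psi>\<omega> unfolding eventually_at_infinity by blast
  \<comment> \<open>A radius r above this bound ensures that every ray starts inside the disk of
    radius r. The sphere of radius \<open>2 * \<rho>0\<close> is used because \<psi> is controlled
    only strictly outside radius \<open>\<rho>0\<close>.\<close>
  have "compact (\<psi> ` sphere 0 (2 * \<rho>0))"
    using \<open>\<rho>0 > 0\<close>
    by (intro compact_continuous_image holomorphic_on_imp_continuous_on holomorphic_on_subset[OF hol\<psi>]) auto
  from compact_imp_bounded[OF this]
  obtain r2 where "\<forall>x \<in> \<psi> ` sphere 0 (2 * \<rho>0). norm x \<le> r2"
    unfolding bounded_iff by blast
  then have r2: "norm (\<psi> Z) \<le> r2" if "norm Z = 2 * \<rho>0" for Z
    using that by simp
  have arcs: "\<exists>A. (\<forall>e\<in>E. unbounded_smooth_arc (A e) \<and>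
      ((\<lambda>z. cis (Arg z)) \<longlongrightarrow> e) (inf at_infinity (principal (A e)))) \<and>
    disjoint_family_on A E \<and> {z. r \<le> norm z \<and> Im (f z) = 0} = (\<Union>e\<in>E. A e)"
    if "r1 \<le> r" "r2 < r" for r
  proof -
    \<comment> \<open>The truncation is by the modulus of the image point, not of the parameter, so
      that the arcs fill exactly the part of the level set with
      \<open>r \<le> norm z\<close>.\<close>
    define A where "A e = (\<lambda>\<rho>. \<psi> (of_real \<rho> * e)) ` {\<rho>. \<rho>0 < \<rho> \<and> r \<le> norm (\<psi> (of_real \<rho> * e))}" for e
    \<comment> \<open>The direction of the ray can be read off from any point of its image; both
      disjointness and the asymptotic direction rest on this.\<close>
    have sgn_\<omega>: "sgn (\<omega> z) = e" if "norm e = 1" "z \<in> A e" for z e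
      using that \<omega>\<psi> \<open>\<rho>0 > 0\<close>
      by (auto simp: A_def norm_mult sgn_mult sgn_of_real sgn_eq)
    have "unbounded_smooth_arc (A e)" if e: "norm e = 1" for e
    proof -
      define N where "N \<rho> = norm (\<psi> (of_real \<rho> * e))" for \<rho>
      have mono: "N a < N b" if "\<rho>0 < a" "a < b" for a b
        unfolding N_def by (rule norm_strict_mono_on_ray[OF hol\<psi> \<open>\<rho>0 > 0\<close> \<psi>_nz \<psi>_pos e that])
      have "\<forall>\<^sub>F Z in at_infinity. r \<le> norm (\<psi> Z)"
        using \<psi>_lim unfolding filterlim_at_infinity_conv_norm_at_top filterlim_at_top by blast
      then obtain b0 where b0: "\<And>Z. b0 \<le> norm Z \<Longrightarrow> r \<le> norm (\<psi> Z)"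
        by (auto simp: eventually_at_infinity)
      define b where "b = max b0 (2 * \<rho>0)"
      have "N (2 * \<rho>0) \<le> r"
        using r2[of "of_real (2 * \<rho>0) * e"] \<open>r2 < r\<close> \<open>\<rho>0 > 0\<close> e by (simp add: N_def norm_mult)
      moreover have "r \<le> N b"
        using b0[of "of_real b * e"] \<open>\<rho>0 > 0\<close> e by (simp add: N_def norm_mult b_def)
      moreover have "continuous_on {2 * \<rho>0..b} N"
        unfolding N_def[abs_def] using \<open>\<rho>0 > 0\<close> e
        by (intro continuous_intros continuous_on_compose2[OF holomorphic_on_imp_continuous_on[OF hol\<psi>]])
          (auto simp: norm_mult)
      \<comment> \<open>The modulus is at most r at parameter \<open>2 * \<rho>0\<close> and at
        least r at b. By strict monotonicity the parameters of the arc then form exactly the closed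
        half-line from a.\<close>
      ultimately obtain a where a: "2 * \<rho>0 \<le> a" "N a = r"
        using IVT'[of N "2 * \<rho>0" r b] by (auto simp: b_def)
      have "{\<rho>. \<rho>0 < \<rho> \<and> r \<le> N \<rho>} = {a..}"
      proof (intro set_eqI iffI)
        fix \<rho> assume "\<rho> \<in> {\<rho>. \<rho>0 < \<rho> \<and> r \<le> N \<rho>}"
        then show "\<rho> \<in> {a..}" using mono[of \<rho> a] a by force
      next
        fix \<rho> assume "\<rho> \<in> {a..}"
        then show "\<rho> \<in> {\<rho>. \<rho>0 < \<rho> \<and> r \<le> N \<rho>}"
          using mono[of a \<rho>] a \<open>\<rho>0 > 0\<close> by (cases "\<rho> = a") auto
      qed
      then have "A e = (\<lambda>\<rho>. \<psi> (of_real \<rho> * e)) ` {a..}"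
        by (simp add: A_def N_def)
      then show ?thesis
        using unbounded_smooth_arc_ray_image[OF hol\<psi> \<open>\<rho>0 > 0\<close> inj \<psi>_lim e, of a] a \<open>\<rho>0 > 0\<close> by simp
    qed
    moreover have "((\<lambda>z. cis (Arg z)) \<longlongrightarrow> e) (inf at_infinity (principal (A e)))" if e: "norm e = 1" for e
    proof -
      \<comment> \<open>On \<open>A e\<close> one has \<open>sgn (\<omega> z) = e\<close>, so
        \<open>sgn z = e / sgn (\<omega> z / z)\<close>, and the denominator tends to 1.\<close>
      have "((\<lambda>z. e / sgn (\<omega> z / z)) \<longlongrightarrow> e / sgn 1) (inf at_infinity (principal (A e)))"
        by (intro tendsto_intros tendsto_mono[OF inf_le1 \<omega>_lim]) auto
      moreover have "\<forall>\<^sub>F z in inf at_infinity (principal (A e)). e / sgn (\<omega> z / z) = cis (Arg z)"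
        unfolding eventually_inf_principal using eventually_not_equal_at_infinity[of 0]
      proof eventually_elim
        case (elim z)
        then show ?case
          using sgn_\<omega>[OF e] e by (auto simp: cis_Arg)
      qed
      ultimately show ?thesis
        using Lim_transform_eventually by fastforce
    qed
    moreover have "disjoint_family_on A E"
      using sgn_\<omega> unfolding disjoint_family_on_def E_def by blast
    moreover have "{z. r \<le> norm z \<and> Im (f z) = 0} = (\<Union>e\<in>E. A e)"
    proof -
      have Im_f: "Im (f (\<psi> (of_real \<rho> * e))) = 0 \<longleftrightarrow> Im (c * e powi m) = 0"
        if "\<rho>0 < \<rho>" "norm e = 1" for \<rho> e
      proof -
        have "c * (of_real \<rho> * e) powi m = of_real (\<rho> powi m) * (c * e powi m)"
          by (simp add: power_int_mult_distrib)
        moreover have "Im (of_real x * q) = x * Im q" for x q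
          by simp
        ultimately have "Im (c * (of_real \<rho> * e) powi m) = \<rho> powi m * Im (c * e powi m)"
          by metis
        then show ?thesis
          using f\<psi>[of "of_real \<rho> * e"] that \<open>\<rho>0 > 0\<close> by (simp add: norm_mult)
      qed
      show ?thesis
      proof (intro set_eqI iffI)
        fix z assume "z \<in> {z. r \<le> norm z \<and> Im (f z) = 0}"
        then have z: "r \<le> norm z" "Im (f z) = 0" by auto
        then have Z: "\<rho>0 < norm (\<omega> z)" "\<psi> (\<omega> z) = z" using r1 \<open>r1 \<le> r\<close> by auto
        define e where "e = sgn (\<omega> z)"
        have e: "norm e = 1" "\<omega> z = of_real (norm (\<omega> z)) * e"
          using Z(1) \<open>\<rho>0 > 0\<close> by (auto simp: e_def norm_sgn) (auto simp: sgn_eq)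
        have "e \<in> E"
          using Im_f[OF Z(1) e(1)] e z Z(2) by (simp add: E_def)
        moreover have "z \<in> A e"
          unfolding A_def using e Z z by (intro image_eqI[of _ _ "norm (\<omega> z)"]) auto
        ultimately show "z \<in> (\<Union>e\<in>E. A e)" by blast
      next
        fix z assume "z \<in> (\<Union>e\<in>E. A e)"
        then show "z \<in> {z. r \<le> norm z \<and> Im (f z) = 0}"
          using Im_f by (auto simp: A_def E_def)
      qed
    qed
    ultimately show ?thesis
      by (intro exI[of _ A]) (auto simp: E_def)
  qed
  show ?thesis
    using eventually_ge_at_top[of r1] eventually_gt_at_top[of r2]
    by eventually_elim (rule arcs)
qed

section \<open>The asymptotic directions and their number\<close>

lemma real_directions_eq_range_cis:
  fixes c :: complex and m :: int
  assumes "c \<noteq> 0" "m \<noteq> 0"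
  shows "{e. norm e = 1 \<and> Im (c * e powi m) = 0} =
    range (\<lambda>j::int. cis ((of_int j * pi - Arg c) / of_int m))"
proof -
  have Im_iff: "Im (c * cis x powi m) = 0 \<longleftrightarrow> sin (Arg c + of_int m * x) = 0" for x
  proof -
    have "c = of_real (norm c) * cis (Arg c)"
      using rcis_cmod_Arg[of c] by (simp add: rcis_def)
    then have "c * cis x powi m = of_real (norm c) * cis (Arg c) * cis x powi m"
      by (rule arg_cong)
    also have "\<dots> = of_real (norm c) * cis (Arg c + of_int m * x)"
      by (simp only: cis_power_int mult.assoc cis_mult)
    finally have "c * cis x powi m = of_real (norm c) * cis (Arg c + of_int m * x)" .
    then show ?thesis using \<open>c \<noteq> 0\<close> by simp
  qed
  show ?thesis
  proof (intro set_eqI iffI)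
    fix e assume "e \<in> {e. norm e = 1 \<and> Im (c * e powi m) = 0}"
    then have e: "norm e = 1" "Im (c * e powi m) = 0" by auto
    then have "e \<noteq> 0" by auto
    then have e_cis: "cis (Arg e) = e"
      using e(1) by (simp add: cis_Arg sgn_eq)
    then have "sin (Arg c + of_int m * Arg e) = 0"
      using e(2) Im_iff[of "Arg e"] by simp
    then obtain j :: int where "Arg c + of_int m * Arg e = of_int j * pi"
      by (auto simp: sin_zero_iff_int2)
    then have "Arg e = (of_int j * pi - Arg c) / of_int m"
      using \<open>m \<noteq> 0\<close> by (simp add: field_simps)
    then show "e \<in> range (\<lambda>j::int. cis ((of_int j * pi - Arg c) / of_int m))"
      using e_cis by (intro range_eqI[of _ _ j]) simp
  next
    fix e assume "e \<in> range (\<lambda>j::int. cis ((of_int j * pi - Arg c) / of_int m))"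
    then obtain j :: int where e: "e = cis ((of_int j * pi - Arg c) / of_int m)" by auto
    have "Arg c + of_int m * ((of_int j * pi - Arg c) / of_int m) = of_int j * pi"
      using \<open>m \<noteq> 0\<close> by simp
    then have "sin (Arg c + of_int m * ((of_int j * pi - Arg c) / of_int m)) = 0"
      by (rule sin_zero_iff_int2[THEN iffD2, OF exI])
    then have "Im (c * e powi m) = 0"
      unfolding e by (rule Im_iff[THEN iffD2])
    moreover have "norm e = 1"
      unfolding e by (rule norm_cis)
    ultimately show "e \<in> {e. norm e = 1 \<and> Im (c * e powi m) = 0}"
      by blast
  qed
qed

text \<open>The parametrisation by integers j repeats each direction infinitely often, so the count
  is algebraic: a unimodular q is real iff q^2 = 1, which turns the condition on e into an equation
  for roots of order 2|m| of a unimodular number s.\<close>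

lemma card_real_directions:
  fixes c :: complex and m :: int
  assumes "c \<noteq> 0" "m \<noteq> 0"
  shows "int (card {e. norm e = 1 \<and> Im (c * e powi m) = 0}) = 2 * \<bar>m\<bar>"
proof -
  \<comment> \<open>Solving (sgn c)^2 e^(2m) = 1 for e^(2|m|) gives the inverse square of sgn c if m
    > 0 and its square if m < 0.\<close>
  define s where "s = (if m > 0 then inverse (sgn c) ^ 2 else sgn c ^ 2)"
  have "norm s = 1" using \<open>c \<noteq> 0\<close> by (simp add: s_def norm_power norm_inverse norm_sgn)
  have real_iff: "Im q = 0 \<longleftrightarrow> q ^ 2 = 1" if "norm q = 1" for q :: complex
  proof -
    have "q * cnj q = 1" using that complex_norm_square[of q] by simp
    then have "q ^ 2 = 1 \<longleftrightarrow> q * q = q * cnj q"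
      by (simp add: power2_eq_square)
    also have "\<dots> \<longleftrightarrow> q = cnj q"
      using that by auto
    finally show ?thesis by (auto simp: complex_eq_iff)
  qed
  have "Im (c * e powi m) = 0 \<longleftrightarrow> e ^ (2 * nat \<bar>m\<bar>) = s" if e: "norm e = 1" for e
  proof -
    have "e \<noteq> 0" using e by auto
    have Im_of_real_mult: "Im (of_real x * q) = x * Im q" for x q
      by simp
    have "c * e powi m = of_real (norm c) * (sgn c * e powi m)"
      using \<open>c \<noteq> 0\<close> by (simp add: sgn_eq)
    then have "Im (c * e powi m) = norm c * Im (sgn c * e powi m)"
      by (simp only: Im_of_real_mult)
    then have "Im (c * e powi m) = 0 \<longleftrightarrow> (sgn c * e powi m) ^ 2 = 1"
      using real_iff[of "sgn c * e powi m"] e \<open>c \<noteq> 0\<close>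
      by (simp add: norm_mult norm_sgn norm_power_int del: times_complex.sel)
    also have "(sgn c * e powi m) ^ 2 = sgn c ^ 2 * e powi (2 * m)"
      by (simp add: power_mult_distrib power_int_mult mult.commute[of 2])
    also have "\<dots> = 1 \<longleftrightarrow> e ^ (2 * nat \<bar>m\<bar>) = s"
    proof (cases "m > 0")
      case True
      then have "e powi (2 * m) = e ^ (2 * nat \<bar>m\<bar>)"
        by (simp add: power_int_def nat_mult_distrib)
      then show ?thesis
        using True \<open>c \<noteq> 0\<close> by (simp add: s_def divide_simps sgn_zero_iff) (simp add: mult.commute)
    next
      case False
      then have "nat (- (2 * m)) = 2 * nat \<bar>m\<bar>"
        by linarith
      then have powi_eq: "e powi (2 * m) = inverse (e ^ (2 * nat \<bar>m\<bar>))"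
        using False \<open>m \<noteq> 0\<close> by (simp add: power_int_def power_inverse)
      show ?thesis
        unfolding powi_eq using False \<open>e \<noteq> 0\<close> by (auto simp: s_def divide_simps)
    qed
    finally show ?thesis .
  qed
  \<comment> \<open>Roots of a unimodular number are unimodular, so dropping the norm condition adds
    no solutions.\<close>
  moreover have "norm e = 1" if "e ^ (2 * nat \<bar>m\<bar>) = s" for e
  proof -
    have "norm e ^ (2 * nat \<bar>m\<bar>) = 1 ^ (2 * nat \<bar>m\<bar>)"
      using that \<open>norm s = 1\<close> by (simp flip: norm_power)
    then show ?thesis
      by (rule power_eq_imp_eq_base) (use \<open>m \<noteq> 0\<close> in auto)
  qed
  ultimately have "{e. norm e = 1 \<and> Im (c * e powi m) = 0} = {e. e ^ (2 * nat \<bar>m\<bar>) = s}"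
    by blast
  also have "card \<dots> = 2 * nat \<bar>m\<bar>"
    using \<open>norm s = 1\<close> \<open>m \<noteq> 0\<close> by (intro card_nth_roots) auto
  finally show ?thesis by simp
qed

section \<open>Application to the inflection curve\<close>

text \<open>The error is O(z^(m-1)), hence o(z^m), and vanishes in the limit after division by z^m.
  For m = 0 the conclusion is the convergence of f itself.\<close>

lemma tendsto_at_infinity_of_bigo:
  fixes f :: "complex \<Rightarrow> complex" and m :: int
  assumes "(\<lambda>z. f z - c * z powi m) \<in> O[at_infinity](\<lambda>z. z powi (m - 1))"
  shows "((\<lambda>z. f z / z powi m) \<longlongrightarrow> c) at_infinity"
proof -
  have nz: "\<forall>\<^sub>F z in at_infinity. z \<noteq> (0 :: complex)"
    by (rule eventually_not_equal_at_infinity)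
  have "((\<lambda>z. z powi (m - 1) / z powi m) \<longlongrightarrow> (0 :: complex)) at_infinity"
    by (rule Lim_transform_eventually[OF tendsto_inverse_0])
      (use nz in eventually_elim, simp add: power_int_diff field_simps)
  then have "(\<lambda>z. z powi (m - 1)) \<in> o[at_infinity](\<lambda>z :: complex. z powi m)"
    by (rule smalloI_tendsto) (use nz in eventually_elim, simp)
  with assms have "(\<lambda>z. f z - c * z powi m) \<in> o[at_infinity](\<lambda>z. z powi m)"
    by (rule landau_o.big_small_trans)
  then have "((\<lambda>z. (f z - c * z powi m) / z powi m) \<longlongrightarrow> 0) at_infinity"
    by (rule smalloD_tendsto)
  then have "((\<lambda>z. (f z - c * z powi m) / z powi m + c) \<longlongrightarrow> 0 + c) at_infinity"
    by (intro tendsto_intros)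
  then have lim: "((\<lambda>z. (f z - c * z powi m) / z powi m + c) \<longlongrightarrow> c) at_infinity"
    by simp
  show ?thesis
    by (rule Lim_transform_eventually[OF lim]) (use nz in eventually_elim, simp add: diff_divide_distrib)
qed

text \<open>Beyond all zeros of P and Q the two nonvanishing conditions hold automatically, and
  taking the closure adds nothing because the level set of the continuous function Im R' is
  relatively closed there.\<close>

lemma inflection_curve_outside_disk:
  assumes "P \<noteq> 0" "Q \<noteq> 0"
  obtains r0 where "deriv (rational_fun Q P) holomorphic_on {z. r0 < norm z}"
    "\<And>r. r0 < r \<Longrightarrow> inflection_curve Q P \<inter> {z. r \<le> norm z} =
       {z. r \<le> norm z \<and> Im (deriv (rational_fun Q P) z) = 0}"
proof -
  let ?f = "deriv (rational_fun Q P)"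
  have "bounded ({z. poly P z = 0} \<union> {z. poly Q z = 0})"
    using assms by (simp add: poly_roots_finite finite_imp_bounded)
  then obtain r0 where "\<forall>z. poly P z = 0 \<or> poly Q z = 0 \<longrightarrow> norm z \<le> r0"
    unfolding bounded_iff by blast
  then have r0: "poly P z \<noteq> 0 \<and> poly Q z \<noteq> 0" if "r0 < norm z" for z
    using that not_le by blast
  define U where "U = {z :: complex. r0 < norm z}"
  define S where "S = {z. rational_fun Q P z \<noteq> 0 \<and> poly P z \<noteq> 0 \<and> Im (?f z) = 0}"
  have "open U"
    unfolding U_def by (intro open_Collect_less continuous_intros)
  have "rational_fun Q P holomorphic_on U"
    unfolding rational_fun_def[abs_def] by (intro holomorphic_intros) (use r0 in \<open>auto simp: U_def\<close>)
  then have hol: "?f holomorphic_on U"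
    using \<open>open U\<close> by (rule holomorphic_deriv)
  \<comment> \<open>An open set that misses S also misses its closure, so closure points in U still
    satisfy Im R' = 0.\<close>
  have "open (U \<inter> (\<lambda>z. Im (?f z)) -` (- {0}))"
    by (rule continuous_open_preimage[OF continuous_on_Im[OF holomorphic_on_imp_continuous_on[OF hol]] \<open>open U\<close>])
      auto
  moreover have "U \<inter> (\<lambda>z. Im (?f z)) -` (- {0}) \<inter> S = {}"
    by (auto simp: S_def)
  ultimately have "U \<inter> (\<lambda>z. Im (?f z)) -` (- {0}) \<inter> closure S = {}"
    by (simp only: open_Int_closure_eq_empty)
  moreover have "z \<in> S" if "z \<in> U" "Im (?f z) = 0" for z
    using that r0[of z] by (simp add: S_def U_def rational_fun_def)
  ultimately have "z \<in> closure S \<longleftrightarrow> Im (?f z) = 0" if "z \<in> U" for z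
    using that closure_subset[of S] by blast
  then have "inflection_curve Q P \<inter> {z. r \<le> norm z} = {z. r \<le> norm z \<and> Im (?f z) = 0}"
    if "r0 < r" for r
    using that unfolding U_def inflection_curve_def S_def by auto
  then show thesis
    using that[of r0] hol unfolding U_def by blast
qed

theorem theorem5p1:
  fixes P Q :: "complex poly" and c :: complex and m :: int
  assumes "P \<noteq> 0"
    and "coprime P Q"
    and "\<not> rational_fun Q P constant_on {z. poly P z \<noteq> 0}"
    and "c \<noteq> 0"
    and "(\<lambda>z. deriv (rational_fun Q P) z - c * z powi m) \<in> O[at_infinity](\<lambda>z. z powi (m - 1))"
  shows
    "(m \<noteq> 0 \<longrightarrow>
       (\<forall>\<^sub>F r in at_top. \<exists>\<A> :: complex set set.
          int (card \<A>) = 2 * \<bar>m\<bar> \<and>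
          (\<forall>A\<in>\<A>. unbounded_smooth_arc A) \<and>
          disjoint \<A> \<and>
          inflection_curve Q P \<inter> {z. r \<le> norm z} = \<Union>\<A> \<and>
          (\<forall>A\<in>\<A>. \<exists>j::int. asymptotic_to_ray A ((of_int j * pi - Arg c) / of_int m)) \<and>
          (\<forall>j::int. \<exists>!A. A \<in> \<A> \<and> asymptotic_to_ray A ((of_int j * pi - Arg c) / of_int m)))) \<and>
     (m = 0 \<longrightarrow>
       (deriv (rational_fun Q P) \<longlongrightarrow> c) at_infinity \<and>
       (Im c \<noteq> 0 \<longrightarrow> bounded (inflection_curve Q P)))"
proof -
  have "Q \<noteq> 0"
    using assms(3) by (auto simp: rational_fun_def constant_on_def)
  obtain r0 where hol: "deriv (rational_fun Q P) holomorphic_on {z. r0 < norm z}"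
    and curve: "\<And>r. r0 < r \<Longrightarrow> inflection_curve Q P \<inter> {z. r \<le> norm z} =
       {z. r \<le> norm z \<and> Im (deriv (rational_fun Q P) z) = 0}"
    using inflection_curve_outside_disk[OF \<open>P \<noteq> 0\<close> \<open>Q \<noteq> 0\<close>] by blast
  note lim = tendsto_at_infinity_of_bigo[OF assms(5)]
  show ?thesis
  proof (intro conjI impI)
    assume "m \<noteq> 0"
    define E where "E = {e. norm e = 1 \<and> Im (c * e powi m) = 0}"
    define \<theta> where "\<theta> j = (of_int j * pi - Arg c) / of_int m" for j :: int
    have E_range: "E = range (\<lambda>j. cis (\<theta> j))"
      unfolding E_def \<theta>_def using real_directions_eq_range_cis[OF \<open>c \<noteq> 0\<close> \<open>m \<noteq> 0\<close>] .
    have "\<forall>\<^sub>F r in at_top. r0 < r" by (rule eventually_gt_at_top)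
    with holomorphic_real_level_arcs_at_infinity[OF hol lim \<open>c \<noteq> 0\<close> \<open>m \<noteq> 0\<close>, folded E_def]
    have "\<forall>\<^sub>F r in at_top. \<exists>\<A>. int (card \<A>) = 2 * \<bar>m\<bar> \<and> (\<forall>A\<in>\<A>. unbounded_smooth_arc A) \<and>
        disjoint \<A> \<and> inflection_curve Q P \<inter> {z. r \<le> norm z} = \<Union>\<A> \<and>
        (\<forall>A\<in>\<A>. \<exists>j. asymptotic_to_ray A (\<theta> j)) \<and> (\<forall>j. \<exists>!A. A \<in> \<A> \<and> asymptotic_to_ray A (\<theta> j))"
    proof eventually_elim
      case (elim r)
      then obtain A where arc: "\<And>e. e \<in> E \<Longrightarrow> unbounded_smooth_arc (A e)"
        and asym: "\<And>e. e \<in> E \<Longrightarrow> ((\<lambda>z. cis (Arg z)) \<longlongrightarrow> e) (inf at_infinity (principal (A e)))"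
        and disj: "disjoint_family_on A E"
        and un: "{z. r \<le> norm z \<and> Im (deriv (rational_fun Q P) z) = 0} = (\<Union>e\<in>E. A e)"
        by blast
      have asym_iff: "asymptotic_to_ray (A e) (\<theta> j) \<longleftrightarrow> e = cis (\<theta> j)" if "e \<in> E" for e j
        using tendsto_unique[OF inf_at_infinity_unbounded_smooth_arc[OF arc] asym] asym that
        unfolding asymptotic_to_ray_def by blast
      \<comment> \<open>An arc determines its limiting direction, so there are as many arcs as
        directions.\<close>
      have "inj_on A E"
      proof (rule inj_onI)
        fix x y assume "x \<in> E" "y \<in> E" "A x = A y"
        from \<open>x \<in> E\<close> obtain j where j: "x = cis (\<theta> j)"
          using E_range by blast
        then have "asymptotic_to_ray (A y) (\<theta> j)"
          using asym_iff[OF \<open>x \<in> E\<close>] \<open>A x = A y\<close> by metis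
        then show "x = y"
          using asym_iff[OF \<open>y \<in> E\<close>] j by metis
      qed
      then have "card (A ` E) = card E"
        by (rule card_image)
      then have "int (card (A ` E)) = 2 * \<bar>m\<bar>"
        using card_real_directions[OF \<open>c \<noteq> 0\<close> \<open>m \<noteq> 0\<close>] unfolding E_def by (simp only:)
      moreover have "disjoint (A ` E)"
        using disj by (rule disjoint_family_on_disjoint_image)
      moreover have "inflection_curve Q P \<inter> {z. r \<le> norm z} = \<Union> (A ` E)"
        using curve elim un by simp
      moreover have "\<forall>a\<in>A ` E. \<exists>j. asymptotic_to_ray a (\<theta> j)"
        using asym_iff E_range by blast
      \<comment> \<open>Different j may give the same ray modulo 2\<pi>; the arc is therefore
        indexed by \<open>cis (\<theta> j)\<close> rather than by j.\<close>
      moreover have "\<forall>j. \<exists>!a. a \<in> A ` E \<and> asymptotic_to_ray a (\<theta> j)"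
      proof
        fix j
        have "cis (\<theta> j) \<in> E" using E_range by blast
        then show "\<exists>!a. a \<in> A ` E \<and> asymptotic_to_ray a (\<theta> j)"
          using asym_iff by (intro ex1I[of _ "A (cis (\<theta> j))"]) auto
      qed
      moreover have "\<forall>a\<in>A ` E. unbounded_smooth_arc a"
        using arc by blast
      ultimately show ?case
        by (intro exI[of _ "A ` E"] conjI)
    qed
    then show "\<forall>\<^sub>F r in at_top. \<exists>\<A> :: complex set set.
        int (card \<A>) = 2 * \<bar>m\<bar> \<and> (\<forall>A\<in>\<A>. unbounded_smooth_arc A) \<and> disjoint \<A> \<and>
        inflection_curve Q P \<inter> {z. r \<le> norm z} = \<Union>\<A> \<and>
        (\<forall>A\<in>\<A>. \<exists>j::int. asymptotic_to_ray A ((of_int j * pi - Arg c) / of_int m)) \<and>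
        (\<forall>j::int. \<exists>!A. A \<in> \<A> \<and> asymptotic_to_ray A ((of_int j * pi - Arg c) / of_int m))"
      unfolding \<theta>_def .
  next
    assume "m = 0"
    then show lim0: "(deriv (rational_fun Q P) \<longlongrightarrow> c) at_infinity"
      using lim by simp
    assume "Im c \<noteq> 0"
    then have "\<forall>\<^sub>F z in at_infinity. Im (deriv (rational_fun Q P) z) \<noteq> 0"
      by (rule tendsto_imp_eventually_ne[OF tendsto_Im[OF lim0]])
    then obtain b where b: "\<And>z. b \<le> norm z \<Longrightarrow> Im (deriv (rational_fun Q P) z) \<noteq> 0"
      unfolding eventually_at_infinity by blast
    \<comment> \<open>Here b bounds the region where Im R' may vanish, and \<open>r0 + 1\<close>
      gives the strict inequality under which the curve is that zero set.\<close>
    define r where "r = max b (r0 + 1)"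
    have "r0 < r" "b \<le> r" by (auto simp: r_def)
    then have "Im (deriv (rational_fun Q P) z) \<noteq> 0" if "r \<le> norm z" for z
      using b that order_trans by blast
    then have "inflection_curve Q P \<inter> {z. r \<le> norm z} = {}"
      unfolding curve[OF \<open>r0 < r\<close>] by blast
    then have "norm z \<le> r" if "z \<in> inflection_curve Q P" for z
      using that linear[of r "norm z"] by blast
    then show "bounded (inflection_curve Q P)"
      unfolding bounded_iff by blast
  qed
qed

end
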